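(* Let $n\ge 2$. A tight $(1,1)$-design in $F_2^n$ exists if and only if $n$ is divisible by $4$ and there exists a Hadamard matrix of order $n$.
   Context: $F_2^n$ is the set of binary vectors of length $n$, with Hamming distance $d(x,y)$, and $\langle x,y\rangle:=1-\frac{2d(x,y)}{n}$. The Krawtchouk polynomials satisfy $Q_0^{(n)}=1$, $Q_1^{(n)}(t)=t$, $ntQ_i^{(n)}(t)=(n-i)Q_{i+1}^{(n)}(t)+iQ_{i-1}^{(n)}(t)$; in particular $Q_2^{(n)}(t)=\frac{nt^2-1}{n-1}$. For a nonempty $C\subseteq F_2^n$ the moments are $M_i(C):=\sum_{x,y\in C}Q_i^{(n)}(\langle x,y\rangle)$ (over all ordered pairs, including $x=y$). $C$ is a $(1,1)$-design if $M_2(C)=0$. A $(1,1)$-design is tight if its cardinality equals $1+\binom{n-1}{1}=n$.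
   Formalization: The hypothesis n ≥ 2 is replaced by n ≥ 3, because the claim fails at n = 2: {00, 01} is a tight (1,1)-design in F_2^2, but 2 is not divisible by 4. *)

theory Defs
  imports "HOL-Library.Z2" "Jordan_Normal_Form.Matrix"
begin

text \<open>The binary space of length \<open>n\<close> is \<open>carrier_vec n :: bit vec set\<close>.\<close>

definition hamming_dist :: "bit vec \<Rightarrow> bit vec \<Rightarrow> nat" where
  "hamming_dist x y = card {i. i < dim_vec x \<and> x $ i \<noteq> y $ i}"

definition hamming_ip :: "nat \<Rightarrow> bit vec \<Rightarrow> bit vec \<Rightarrow> real" where
  "hamming_ip n x y = 1 - 2 * real (hamming_dist x y) / real n"

text \<open>
  The three-term recurrence \<open>n t Q\<^sub>i(t) = (n - i) Q\<^sub>i\<^sub>+\<^sub>1(t) + i Q\<^sub>i\<^sub>-\<^sub>1(t)\<close>, solved for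
  \<open>Q\<^sub>i\<^sub>+\<^sub>1\<close> and shifted by one.  It determines \<open>Q\<^sub>i\<close> for \<open>i \<le> n\<close> only; values at
  larger indices (where a division by zero occurs) carry no meaning.
\<close>

fun krawtchouk :: "nat \<Rightarrow> nat \<Rightarrow> real \<Rightarrow> real" where
  "krawtchouk n 0 t = 1"
| "krawtchouk n (Suc 0) t = t"
| "krawtchouk n (Suc (Suc i)) t =
     (real n * t * krawtchouk n (Suc i) t - real (Suc i) * krawtchouk n i t)
       / (real n - real (Suc i))"

lemma krawtchouk_2: "krawtchouk n 2 t = (real n * t\<^sup>2 - 1) / (real n - 1)"
  by (simp add: numeral_2_eq_2 power2_eq_square)

definition moment :: "nat \<Rightarrow> nat \<Rightarrow> bit vec set \<Rightarrow> real" where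
  "moment n i C = (\<Sum>x\<in>C. \<Sum>y\<in>C. krawtchouk n i (hamming_ip n x y))"

definition design_1_1 :: "nat \<Rightarrow> bit vec set \<Rightarrow> bool" where
  "design_1_1 n C \<longleftrightarrow> C \<noteq> {} \<and> C \<subseteq> carrier_vec n \<and> moment n 2 C = 0"

definition tight_design_1_1 :: "nat \<Rightarrow> bit vec set \<Rightarrow> bool" where
  "tight_design_1_1 n C \<longleftrightarrow> design_1_1 n C \<and> card C = 1 + ((n - 1) choose 1)"

definition hadamard_matrix :: "nat \<Rightarrow> int mat \<Rightarrow> bool" where
  "hadamard_matrix n H \<longleftrightarrow>
     H \<in> carrier_mat n n \<and>
     (\<forall>i<n. \<forall>j<n. H $$ (i, j) = 1 \<or> H $$ (i, j) = - 1) \<and>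
     H * transpose_mat H = int n \<cdot>\<^sub>m 1\<^sub>m n"

text \<open>
  Length 2 is exceptional: the code \<open>{00, 01}\<close> is a tight design although 2 is not
  divisible by 4.
\<close>

lemma tight_design_1_1_length_2: "\<exists>C. tight_design_1_1 2 C"
proof -
  let ?x = "vec 2 (\<lambda>i. 0) :: bit vec" and ?y = "vec 2 (\<lambda>i. if i = Suc 0 then 1 else 0) :: bit vec"
  have "?x $ 1 \<noteq> ?y $ 1" by simp
  hence ne: "?x \<noteq> ?y" by metis
  have "{i. i < 2 \<and> ?x $ i \<noteq> ?y $ i} = {1}" "{i. i < 2 \<and> ?y $ i \<noteq> ?x $ i} = {1}"
    by (auto split: if_splits)
  hence d: "hamming_dist ?x ?y = 1" "hamming_dist ?y ?x = 1"
    "hamming_dist ?x ?x = 0" "hamming_dist ?y ?y = 0"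
    by (auto simp: hamming_dist_def)
  have "moment 2 2 {?x, ?y} = 0"
    unfolding moment_def krawtchouk_2 hamming_ip_def using ne by (simp add: d)
  hence "tight_design_1_1 2 {?x, ?y}"
    using ne by (auto simp: tight_design_1_1_def design_1_1_def)
  thus ?thesis by blast
qed

end

theory Submission
  imports Defs
begin

text \<open>
  For a code of size \<open>n\<close> the moment condition reads \<open>\<Sum> \<langle>x,y\<rangle>\<^sup>2 = n\<close>, and the diagonal pairs
  already contribute \<open>n\<close>; so distinct words are orthogonal, which means that the words, read
  as \<open>\<plusminus>1\<close> vectors, are the rows of a Hadamard matrix.  That \<open>4\<close> divides \<open>n\<close> follows from three
  rows \<open>a\<close>, \<open>b\<close>, \<open>c\<close>: orthogonality gives \<open>\<Sum> (a\<^sub>k + b\<^sub>k) (a\<^sub>k + c\<^sub>k) = n\<close>, and each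
  summand is a product of two even numbers.
\<close>

text \<open>Values lie in \<open>int\<close> because the entries of \<open>hadamard_matrix\<close>
  do. Bit 0 becomes 1, so agreeing coordinates have product 1 and differing ones -1.\<close>

definition spin :: "bit \<Rightarrow> int" where
  "spin b = (if b = 0 then 1 else - 1)"

lemma spin_cases: "spin b = 1 \<or> spin b = - 1"
  by (simp add: spin_def)

lemma sum_spin_mult:
  assumes "dim_vec x = n"
  shows "(\<Sum>k<n. spin (x $ k) * spin (y $ k)) = int n - 2 * int (hamming_dist x y)"
proof -
  have "spin a * spin b = 1 - 2 * of_bool (a \<noteq> b)" for a b
    by (cases a; cases b) (simp_all add: spin_def)
  hence "(\<Sum>k<n. spin (x $ k) * spin (y $ k)) = (\<Sum>k<n. 1 - 2 * of_bool (x $ k \<noteq> y $ k))"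
    by simp
  also have "\<dots> = int n - 2 * (\<Sum>k<n. of_bool (x $ k \<noteq> y $ k))"
    by (simp only: sum_subtractf sum_distrib_left) simp
  also have "(\<Sum>k<n. of_bool (x $ k \<noteq> y $ k)) = int (card ({..<n} \<inter> {k. x $ k \<noteq> y $ k}))"
    by (subst sum_of_bool_eq) simp_all
  also have "{..<n} \<inter> {k. x $ k \<noteq> y $ k} = {k. k < dim_vec x \<and> x $ k \<noteq> y $ k}"
    using assms by auto
  finally show ?thesis by (simp add: hamming_dist_def)
qed

lemma hamming_ip_eq_0_iff:
  assumes "dim_vec x = n" "n > 0"
  shows "hamming_ip n x y = 0 \<longleftrightarrow> (\<Sum>k<n. spin (x $ k) * spin (y $ k)) = 0"
proof -
  have "hamming_ip n x y = 0 \<longleftrightarrow> real n = real (2 * hamming_dist x y)"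
    using assms(2) by (simp add: hamming_ip_def field_simps)
  also have "\<dots> \<longleftrightarrow> n = 2 * hamming_dist x y"
    by (rule of_nat_eq_iff)
  finally show ?thesis
    unfolding sum_spin_mult[OF assms(1)] by linarith
qed

lemma hamming_ip_same [simp]: "hamming_ip n x x = 1"
  by (simp add: hamming_ip_def hamming_dist_def)

lemma moment_2_eq_0_iff_orthogonal:
  assumes "card C = n" "n \<ge> 2"
  shows "moment n 2 C = 0 \<longleftrightarrow> (\<forall>x\<in>C. \<forall>y\<in>C. x \<noteq> y \<longrightarrow> hamming_ip n x y = 0)"
proof -
  \<comment> \<open>An infinite set has \<open>card\<close> 0, so a cardinality of at least 2 forces
    finiteness.\<close>
  have fin: "finite C" using assms by (metis card.infinite not_numeral_le_zero)
  let ?off = "\<Sum>x\<in>C. \<Sum>y\<in>C - {x}. (hamming_ip n x y)\<^sup>2"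
  have diag: "(\<Sum>y\<in>C. (hamming_ip n x y)\<^sup>2) = 1 + (\<Sum>y\<in>C - {x}. (hamming_ip n x y)\<^sup>2)"
    if "x \<in> C" for x
    using that fin by (simp add: sum.remove)
  have "moment n 2 C = (\<Sum>x\<in>C. \<Sum>y\<in>C. real n * (hamming_ip n x y)\<^sup>2 - 1) / (real n - 1)"
    by (simp add: moment_def krawtchouk_2 sum_divide_distrib)
  also have "(\<Sum>x\<in>C. \<Sum>y\<in>C. real n * (hamming_ip n x y)\<^sup>2 - 1)
      = real n * (\<Sum>x\<in>C. \<Sum>y\<in>C. (hamming_ip n x y)\<^sup>2) - real n * real n"
    using assms(1) by (simp add: sum_subtractf sum_distrib_left)
  also have "(\<Sum>x\<in>C. \<Sum>y\<in>C. (hamming_ip n x y)\<^sup>2) = real n + ?off"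
    using assms(1) by (simp add: diag sum.distrib)
  \<comment> \<open>The diagonal part \<open>real n * real n\<close> cancels the subtracted
    constant, leaving \<open>?off\<close> times the nonzero factor n / (n - 1).\<close>
  finally have "moment n 2 C = 0 \<longleftrightarrow> ?off = 0"
    using assms(2) by (simp add: algebra_simps)
  also have "\<dots> \<longleftrightarrow> (\<forall>x\<in>C. \<forall>y\<in>C. x \<noteq> y \<longrightarrow> hamming_ip n x y = 0)"
    using fin by (subst sum_nonneg_eq_0_iff) (auto simp: sum_nonneg sum_nonneg_eq_0_iff)
  finally show ?thesis .
qed

text \<open>Passes from the real-valued \<open>hamming_ip\<close> to integer sign sums, the form
  shared with rows of matrices. Nonemptiness of \<open>C\<close> is absorbed by
  \<open>card C = n\<close>.\<close>

lemma tight_design_1_1_iff_orthogonal: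
  assumes "n \<ge> 2"
  shows "tight_design_1_1 n C \<longleftrightarrow> C \<subseteq> carrier_vec n \<and> card C = n \<and>
    (\<forall>x\<in>C. \<forall>y\<in>C. x \<noteq> y \<longrightarrow> (\<Sum>k<n. spin (x $ k) * spin (y $ k)) = 0)"
proof -
  have "tight_design_1_1 n C \<longleftrightarrow> C \<subseteq> carrier_vec n \<and> card C = n \<and> moment n 2 C = 0"
    using assms by (auto simp: tight_design_1_1_def design_1_1_def)
  moreover have "hamming_ip n x y = 0 \<longleftrightarrow> (\<Sum>k<n. spin (x $ k) * spin (y $ k)) = 0"
    if "C \<subseteq> carrier_vec n" "x \<in> C" for x y
    using that assms by (intro hamming_ip_eq_0_iff) auto
  ultimately show ?thesis
    using assms by (auto simp: moment_2_eq_0_iff_orthogonal)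
qed

text \<open>Entries of \<open>H * transpose_mat H\<close> are inner products of rows. Signs square
  to 1, so the diagonal entries are n automatically and only the off-diagonal ones carry a
  condition.\<close>

lemma hadamard_matrix_iff_rows:
  assumes "H \<in> carrier_mat n n"
    and "\<And>i j. i < n \<Longrightarrow> j < n \<Longrightarrow> H $$ (i, j) = 1 \<or> H $$ (i, j) = - 1"
  shows "hadamard_matrix n H \<longleftrightarrow>
    (\<forall>i<n. \<forall>j<n. i \<noteq> j \<longrightarrow> (\<Sum>k<n. H $$ (i, k) * H $$ (j, k)) = 0)"
proof -
  have entry: "(H * transpose_mat H) $$ (i, j) = (\<Sum>k<n. H $$ (i, k) * H $$ (j, k))"
    if "i < n" "j < n" for i j
    using that assms(1) by (auto simp: scalar_prod_def lessThan_atLeast0 intro!: sum.cong)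
  have "H $$ (i, k) * H $$ (i, k) = 1" if "i < n" "k < n" for i k
    using assms(2)[OF that] by auto
  hence diag: "(\<Sum>k<n. H $$ (i, k) * H $$ (i, k)) = int n" if "i < n" for i
    using that by simp
  have "hadamard_matrix n H \<longleftrightarrow> H * transpose_mat H = int n \<cdot>\<^sub>m 1\<^sub>m n"
    using assms by (auto simp: hadamard_matrix_def)
  also have "\<dots> \<longleftrightarrow> (\<forall>i<n. \<forall>j<n. (\<Sum>k<n. H $$ (i, k) * H $$ (j, k)) = (if i = j then int n else 0))"
    using assms(1) by (auto simp del: index_mult_mat(1) simp add: mat_eq_iff entry)
  finally show ?thesis
    by (auto simp: diag)
qed

lemma sum_orthogonal_signs_dvd_4:
  fixes a b c :: "nat \<Rightarrow> int"
  assumes "\<And>k. k < n \<Longrightarrow> a k = 1 \<or> a k = - 1"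
    and "\<And>k. k < n \<Longrightarrow> b k = 1 \<or> b k = - 1"
    and "\<And>k. k < n \<Longrightarrow> c k = 1 \<or> c k = - 1"
    and "(\<Sum>k<n. a k * b k) = 0" "(\<Sum>k<n. a k * c k) = 0" "(\<Sum>k<n. b k * c k) = 0"
  shows "4 dvd n"
proof -
  have "a k * a k = 1" if "k < n" for k
    using assms(1)[OF that] by auto
  \<comment> \<open>Expanding gives \<open>a k * a k\<close>, summing to n, and three cross products
    whose sums vanish.\<close>
  hence "(\<Sum>k<n. (a k + b k) * (a k + c k)) = int n"
    using assms(4-6) by (simp add: algebra_simps sum.distrib)
  moreover have "4 dvd (a k + b k) * (a k + c k)" if "k < n" for k
    using assms(1-3)[OF that] by auto
  ultimately have "4 dvd int n"
    by (metis (no_types, lifting) dvd_sum lessThan_iff)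
  thus ?thesis by presburger
qed

lemma hadamard_matrix_dvd_4:
  assumes "hadamard_matrix n H" "n \<ge> 3"
  shows "4 dvd n"
proof -
  have H: "H \<in> carrier_mat n n"
    "\<And>i j. i < n \<Longrightarrow> j < n \<Longrightarrow> H $$ (i, j) = 1 \<or> H $$ (i, j) = - 1"
    using assms(1) by (auto simp: hadamard_matrix_def)
  have orth: "(\<Sum>k<n. H $$ (i, k) * H $$ (j, k)) = 0" if "i < n" "j < n" "i \<noteq> j" for i j
    using hadamard_matrix_iff_rows[OF H] assms(1) that by blast
  show ?thesis
    \<comment> \<open>Three distinct rows exist only from order 3 on; order 2 does have a Hadamard
      matrix.\<close>
    by (rule sum_orthogonal_signs_dvd_4[of n "\<lambda>k. H $$ (0, k)" "\<lambda>k. H $$ (1, k)" "\<lambda>k. H $$ (2, k)"])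
      (use assms(2) in \<open>simp_all add: H orth\<close>)
qed

lemma tight_design_1_1_imp_hadamard_matrix:
  assumes "tight_design_1_1 n C" "n \<ge> 2"
  shows "\<exists>H. hadamard_matrix n H"
proof -
  have C: "card C = n"
    "\<And>x y. x \<in> C \<Longrightarrow> y \<in> C \<Longrightarrow> x \<noteq> y \<Longrightarrow> (\<Sum>k<n. spin (x $ k) * spin (y $ k)) = 0"
    using assms by (auto simp: tight_design_1_1_iff_orthogonal)
  have "finite C" using C(1) assms(2) by (metis card.infinite not_numeral_le_zero)
  then obtain f where f: "bij_betw f {..<n} C"
    using C(1) by (metis ex_bij_betw_nat_finite lessThan_atLeast0)
  \<comment> \<open>Any enumeration of the code serves; injectivity of \<open>f\<close> makes
    different row indices give distinct, hence orthogonal, words.\<close>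
  have "hadamard_matrix n (mat n n (\<lambda>(i, k). spin (f i $ k)))"
  proof (subst hadamard_matrix_iff_rows, goal_cases)
    case (2 i j)
    thus ?case using spin_cases by simp
  next
    case 3
    show ?case
      using C(2) f by (auto simp: bij_betw_def inj_on_eq_iff)
  qed simp
  thus ?thesis ..
qed

lemma hadamard_matrix_imp_tight_design_1_1:
  assumes "hadamard_matrix n H" "n \<ge> 2"
  shows "\<exists>C. tight_design_1_1 n C"
proof -
  have H: "H \<in> carrier_mat n n"
    "\<And>i j. i < n \<Longrightarrow> j < n \<Longrightarrow> H $$ (i, j) = 1 \<or> H $$ (i, j) = - 1"
    using assms(1) by (auto simp: hadamard_matrix_def)
  have orth: "(\<Sum>k<n. H $$ (i, k) * H $$ (j, k)) = 0" if "i < n" "j < n" "i \<noteq> j" for i j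
    using hadamard_matrix_iff_rows[OF H] assms(1) that by blast
  \<comment> \<open>Inverse of \<open>spin\<close> applied to row i: the entry 1 becomes bit 0, and
    -1 becomes bit 1.\<close>
  define f :: "nat \<Rightarrow> bit vec" where "f i = vec n (\<lambda>k. of_bool (H $$ (i, k) \<noteq> 1))" for i
  have spin_f: "spin (f i $ k) = H $$ (i, k)" if "i < n" "k < n" for i k
    using H(2)[OF that] that by (auto simp: f_def spin_def)
  have ip: "(\<Sum>k<n. spin (f i $ k) * spin (f j $ k)) = 0" if "i < n" "j < n" "i \<noteq> j" for i j
    using orth[OF that] that by (simp add: spin_f)
  have "spin b * spin b = 1" for b
    using spin_cases[of b] by auto
  hence self: "(\<Sum>k<n. spin (x $ k) * spin (x $ k)) = int n" for x
    by simp
  \<comment> \<open>The code is a set, so coinciding rows would lower its cardinality. Equal rows at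
    different indices would have inner product both n and 0.\<close>
  have "inj_on f {..<n}"
  proof (rule inj_onI, rule ccontr)
    fix i j assume "i \<in> {..<n}" "j \<in> {..<n}" "f i = f j" "i \<noteq> j"
    hence "int n = 0"
      using ip[of i j] self[of "f j"] by simp
    thus False using assms(2) by simp
  qed
  hence "card (f ` {..<n}) = n"
    by (simp add: card_image)
  moreover have "f ` {..<n} \<subseteq> carrier_vec n"
    by (auto simp: f_def)
  ultimately have "tight_design_1_1 n (f ` {..<n})"
    using ip assms(2) by (auto simp: tight_design_1_1_iff_orthogonal)
  thus ?thesis ..
qed

text \<open>The bound is 3 because the equivalence fails at n = 2, as
  \<open>tight_design_1_1_length_2\<close> shows. Divisibility by 4 for a design is obtained through
  its Hadamard matrix.\<close>

theorem theorem5p2: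
  fixes n :: nat
  assumes "n \<ge> 3"
  shows "(\<exists>C. tight_design_1_1 n C) \<longleftrightarrow> 4 dvd n \<and> (\<exists>H. hadamard_matrix n H)"
proof -
  have "n \<ge> 2" using assms by simp
  thus ?thesis
    using assms tight_design_1_1_imp_hadamard_matrix hadamard_matrix_dvd_4
      hadamard_matrix_imp_tight_design_1_1 by blast
qed

end
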